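(* Let $\mathbb X$ be an aperiodic flow space represented by a proper symbolic sequence $\mathcal S=(\mathcal A_i,s_i)_{i\in\mathbb Z^+}$. Then the flow on $\mathbb X$ is minimal if and only if $\mathcal S$ is primitive.
   Context: A flow space is a compact metrizable space of topological dimension one with a continuous $\mathbb R$-action without fixed points; minimal means every orbit is dense, aperiodic means no orbit is homeomorphic to a circle. An expansion of $\mathbb X$ about $x_\bullet$: oriented wedges of circles $X_i$, positive maps $f_i\colon X_{i+1}\to X_i$ (continuous surjections, wedge point to wedge point, orientation preserving on each circle, locally injective away from the wedge point), projections $p_i\colon\mathbb X\to X_i$ (continuous surjections, locally injective and orientation preserving along orbits) with $p_i(x_\bullet)$ the wedge point, $p_n=f_n\circ\cdots\circ f_{m-1}\circ p_m$ ($m>n$), and $x\mapsto(p_i(x))_i$ a homeomorphism onto $\varprojlim(X_i,f_i)$. A symbolic sequence $\mathcal S$ (finite alphabets $\mathcal A_i$, maps $s_i\colon\mathcal A_{i+1}\to\mathcal A_i^*$) represents $\mathbb X$ if for some expansion and labellings of the circles of $X_i$ by $\mathcal A_i$, $s_i(b)$ is the ordered word of circles of $X_i$ traversed by the image of circle $b$ under $f_i$ (traversed once positively from the wedge point). Composition of symbolic maps is by concatenation: $(s\circ t)(c)=s(b_1)\cdots s(b_k)$ if $t(c)=b_1\cdots b_k$. A map $s\colon\mathcal B\to\mathcal A^*$ is proper if there are $c,d\in\mathcal A$ with every $s(b)=c\,v_b\,d$ ($v_b$ possibly empty), and primitive if every $s(b)$ contains every letter of $\mathcal A$. $\mathcal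 S$ is proper (resp. primitive) if for each $n$ there is $m>n$ with $s_n\circ\cdots\circ s_{m-1}$ proper (resp. primitive). *)

theory Defs
  imports "HOL-Analysis.Analysis"
begin

definition cover_dim_le :: "'a::topological_space set \<Rightarrow> nat \<Rightarrow> bool" where
  "cover_dim_le X n \<longleftrightarrow>
     (\<forall>\<U>. finite \<U> \<and> (\<forall>U\<in>\<U>. openin (top_of_set X) U) \<and> \<Union>\<U> = X \<longrightarrow>
        (\<exists>\<V>. finite \<V> \<and> (\<forall>V\<in>\<V>. openin (top_of_set X) V) \<and> \<Union>\<V> = X \<and>
              (\<forall>V\<in>\<V>. \<exists>U\<in>\<U>. V \<subseteq> U) \<and>
              (\<forall>x\<in>X. card {V\<in>\<V>. x \<in> V} \<le> Suc n)))"

definition topological_dim_one :: "'a::topological_space set \<Rightarrow> bool" where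
  "topological_dim_one X \<longleftrightarrow> X \<noteq> {} \<and> cover_dim_le X 1 \<and> \<not> cover_dim_le X 0"

definition flow_space :: "'a::metric_space set \<Rightarrow> (real \<Rightarrow> 'a \<Rightarrow> 'a) \<Rightarrow> bool" where
  "flow_space X \<phi> \<longleftrightarrow>
     compact X \<and> topological_dim_one X \<and>
     (\<forall>x\<in>X. \<forall>t. \<phi> t x \<in> X) \<and>
     continuous_on (UNIV \<times> X) (\<lambda>(t, x). \<phi> t x) \<and>
     (\<forall>x\<in>X. \<phi> 0 x = x) \<and>
     (\<forall>x\<in>X. \<forall>s t. \<phi> (s + t) x = \<phi> s (\<phi> t x)) \<and>
     (\<forall>x\<in>X. \<exists>t. \<phi> t x \<noteq> x)"

definition orbit :: "(real \<Rightarrow> 'a \<Rightarrow> 'a) \<Rightarrow> 'a \<Rightarrow> 'a set" where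
  "orbit \<phi> x = range (\<lambda>t. \<phi> t x)"

definition minimal_flow :: "'a::metric_space set \<Rightarrow> (real \<Rightarrow> 'a \<Rightarrow> 'a) \<Rightarrow> bool" where
  "minimal_flow X \<phi> \<longleftrightarrow> (\<forall>x\<in>X. X \<subseteq> closure (orbit \<phi> x))"

definition aperiodic_flow :: "'a::metric_space set \<Rightarrow> (real \<Rightarrow> 'a \<Rightarrow> 'a) \<Rightarrow> bool" where
  "aperiodic_flow X \<phi> \<longleftrightarrow> (\<forall>x\<in>X. \<not> (orbit \<phi> x homeomorphic sphere (0::complex) 1))"

text \<open>The wedge of circles indexed by the finite set A, realised inside
  'b \<Rightarrow> complex (product topology): circle a is {emb a z | |z| = 1}, oriented
  by increasing argument of z; the wedge point is the zero function (z = 1).\<close>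
definition wpt :: "'b \<Rightarrow> complex" where
  "wpt = (\<lambda>_. 0)"

definition emb :: "'b \<Rightarrow> complex \<Rightarrow> ('b \<Rightarrow> complex)" where
  "emb a z = (\<lambda>c. if c = a then z - 1 else 0)"

definition wedge :: "'b set \<Rightarrow> ('b \<Rightarrow> complex) set" where
  "wedge A = insert wpt {emb a z | a z. a \<in> A \<and> cmod z = 1}"

definition pos_path :: "(real \<Rightarrow> ('b \<Rightarrow> complex)) \<Rightarrow> real set \<Rightarrow> bool" where
  "pos_path \<gamma> T \<longleftrightarrow>
     (\<forall>t0\<in>T. \<exists>\<epsilon>>0. {t0 - \<epsilon>..t0 + \<epsilon>} \<subseteq> T \<and> inj_on \<gamma> {t0 - \<epsilon>..t0 + \<epsilon>} \<and>
        (\<exists>a \<theta>. continuous_on {t0 - \<epsilon>..t0} \<theta> \<and> strict_mono_on {t0 - \<epsilon>..t0} \<theta> \<and>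
               (\<forall>t\<in>{t0 - \<epsilon>..t0}. \<gamma> t = emb a (cis (\<theta> t)))) \<and>
        (\<exists>b \<theta>. continuous_on {t0..t0 + \<epsilon>} \<theta> \<and> strict_mono_on {t0..t0 + \<epsilon>} \<theta> \<and>
               (\<forall>t\<in>{t0..t0 + \<epsilon>}. \<gamma> t = emb b (cis (\<theta> t)))))"

definition pos_map :: "'b set \<Rightarrow> 'b set \<Rightarrow> (('b \<Rightarrow> complex) \<Rightarrow> ('b \<Rightarrow> complex)) \<Rightarrow> bool" where
  "pos_map B A f \<longleftrightarrow>
     continuous_on (wedge B) f \<and> f ` wedge B = wedge A \<and> f wpt = wpt \<and>
     (\<forall>b\<in>B. pos_path (\<lambda>t. f (emb b (cis t))) {0<..<2 * pi})"

definition traverses :: "(real \<Rightarrow> ('b \<Rightarrow> complex)) \<Rightarrow> 'b list \<Rightarrow> bool" where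
  "traverses \<gamma> w \<longleftrightarrow>
     (\<exists>t::nat \<Rightarrow> real. t 0 = 0 \<and> t (length w) = 2 * pi \<and>
        (\<forall>j<length w. t j < t (Suc j)) \<and>
        (\<forall>j\<le>length w. \<gamma> (t j) = wpt) \<and>
        (\<forall>j<length w. \<forall>u\<in>{t j<..<t (Suc j)}. \<gamma> u \<noteq> wpt \<and> (\<exists>z. \<gamma> u = emb (w ! j) z)))"

definition invlim :: "(nat \<Rightarrow> 'b set) \<Rightarrow> (nat \<Rightarrow> ('b \<Rightarrow> complex) \<Rightarrow> ('b \<Rightarrow> complex))
                       \<Rightarrow> (nat \<Rightarrow> 'b \<Rightarrow> complex) set" where
  "invlim A f = {\<xi>. \<forall>i. \<xi> i \<in> wedge (A i) \<and> \<xi> i = f i (\<xi> (Suc i))}"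

definition symbolic_seq :: "(nat \<Rightarrow> 'b set) \<Rightarrow> (nat \<Rightarrow> 'b \<Rightarrow> 'b list) \<Rightarrow> bool" where
  "symbolic_seq A s \<longleftrightarrow> (\<forall>i. finite (A i)) \<and> (\<forall>i. \<forall>b\<in>A (Suc i). set (s i b) \<subseteq> A i)"

text \<open>symcomp s n k = s_n \<circ> ... \<circ> s_(n+k-1) (composition by concatenation).\<close>
fun symcomp :: "(nat \<Rightarrow> 'b \<Rightarrow> 'b list) \<Rightarrow> nat \<Rightarrow> nat \<Rightarrow> 'b \<Rightarrow> 'b list" where
  "symcomp s n 0 = (\<lambda>c. [c])"
| "symcomp s n (Suc k) = (\<lambda>c. concat (map (symcomp s n k) (s (n + k) c)))"

definition proper_map :: "'b set \<Rightarrow> 'b set \<Rightarrow> ('b \<Rightarrow> 'b list) \<Rightarrow> bool" where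
  "proper_map B A u \<longleftrightarrow> (\<exists>c\<in>A. \<exists>d\<in>A. \<forall>b\<in>B. \<exists>v. u b = [c] @ v @ [d])"

definition primitive_map :: "'b set \<Rightarrow> 'b set \<Rightarrow> ('b \<Rightarrow> 'b list) \<Rightarrow> bool" where
  "primitive_map B A u \<longleftrightarrow> (\<forall>b\<in>B. \<forall>a\<in>A. a \<in> set (u b))"

definition proper_seq :: "(nat \<Rightarrow> 'b set) \<Rightarrow> (nat \<Rightarrow> 'b \<Rightarrow> 'b list) \<Rightarrow> bool" where
  "proper_seq A s \<longleftrightarrow> (\<forall>n. \<exists>m>n. proper_map (A m) (A n) (symcomp s n (m - n)))"

definition primitive_seq :: "(nat \<Rightarrow> 'b set) \<Rightarrow> (nat \<Rightarrow> 'b \<Rightarrow> 'b list) \<Rightarrow> bool" where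
  "primitive_seq A s \<longleftrightarrow> (\<forall>n. \<exists>m>n. primitive_map (A m) (A n) (symcomp s n (m - n)))"

definition represents :: "'a::metric_space set \<Rightarrow> (real \<Rightarrow> 'a \<Rightarrow> 'a) \<Rightarrow>
                          (nat \<Rightarrow> 'b set) \<Rightarrow> (nat \<Rightarrow> 'b \<Rightarrow> 'b list) \<Rightarrow> bool" where
  "represents X \<phi> A s \<longleftrightarrow>
     (\<exists>f p x0. x0 \<in> X \<and>
        (\<forall>i. pos_map (A (Suc i)) (A i) (f i)) \<and>
        (\<forall>i. continuous_on X (p i) \<and> p i ` X = wedge (A i) \<and> p i x0 = wpt \<and>
             (\<forall>x\<in>X. pos_path (\<lambda>t. p i (\<phi> t x)) UNIV)) \<and>
        (\<forall>i. \<forall>x\<in>X. p i x = f i (p (Suc i) x)) \<and>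
        (\<exists>g. homeomorphism X (invlim A f) (\<lambda>x i. p i x) g) \<and>
        (\<forall>i. \<forall>b\<in>A (Suc i). traverses (\<lambda>t. f i (emb b (cis t))) (s i b)))"

end

(* A positive path in a wedge of circles that leaves the wedge point and comes back to it must run
   through a whole circle, since it cannot backtrack. Hence a bonding map takes circle c onto the
   union of the circles lettered by the word of c. Every orbit passes over the wedge point of X_m
   infinitely often, so its projection contains a full circle of X_m; when the sequence is
   primitive, a full circle covers X_n for suitable m > n, so every orbit projects onto every X_n
   and is dense. Conversely, aperiodicity makes the times between passages over the wedge point of
   X_m tend to infinity with m, whereas orbits of a minimal flow visit each circle of X_n within
   uniformly bounded time; so the traversal of any one circle of X_m meets all circles of X_n. *)
theory Submission
  imports Defs
begin

section \<open>Coordinates on a wedge of circles\<close>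

lemma emb_eq_wpt_iff [simp]: "emb a z = wpt \<longleftrightarrow> z = 1"
  by (auto simp: emb_def wpt_def fun_eq_iff)

lemma emb_self [simp]: "emb a z a = z - 1"
  by (simp add: emb_def)

lemma emb_eqD:
  assumes "emb a z = emb b w" "z \<noteq> 1"
  shows "a = b" "z = w"
proof -
  have "emb a z a = emb b w a" using assms by simp
  then show "a = b" using assms(2) by (auto simp: emb_def split: if_splits)
  then show "z = w" using assms(1) by (metis emb_self diff_add_cancel)
qed

definition circ :: "'b \<Rightarrow> ('b \<Rightarrow> complex) set" where
  "circ a = emb a ` sphere 0 1"

lemma wedge_eq: "wedge A = insert wpt (\<Union>a\<in>A. circ a)"
  by (auto simp: wedge_def circ_def)

lemma emb_in_circ: "cmod z = 1 \<Longrightarrow> emb a z \<in> circ a"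
  by (simp add: circ_def)

lemma wpt_in_circ [simp]: "wpt \<in> circ a"
  unfolding circ_def by (metis emb_eq_wpt_iff imageI mem_sphere_0 norm_one)

text \<open>As \<open>emb\<close> subtracts 1, the complex parameter of a point on circle
  \<open>a\<close> is recovered as \<open>1 + x a\<close>; the angle arguments below work with this
  expression.\<close>

lemma mem_circ_iff: "x \<in> circ a \<longleftrightarrow> x = emb a (1 + x a) \<and> cmod (1 + x a) = 1"
  by (auto simp: circ_def image_iff)

text \<open>Away from the wedge point exactly one coordinate is nonzero, so a nonzero coordinate
  names the circle. Circles are told apart in this way throughout.\<close>

lemma wedge_coord:
  assumes "x \<in> wedge A" "x a \<noteq> 0"
  shows "a \<in> A" "x \<in> circ a"
proof -
  have "a \<in> A \<and> x \<in> circ a"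
    using assms by (auto simp: wedge_eq wpt_def circ_def emb_def split: if_splits)
  then show "a \<in> A" "x \<in> circ a" by auto
qed

lemma wedge_obtain_circ:
  assumes "x \<in> wedge A" "x \<noteq> wpt"
  obtains a where "a \<in> A" "x \<in> circ a" "x a \<noteq> 0"
proof -
  obtain a where "x a \<noteq> 0" using assms(2) by (auto simp: wpt_def)
  then show ?thesis using wedge_coord[OF assms(1)] that by blast
qed

lemma circ_coord_neq_0: "x \<in> circ a \<Longrightarrow> x a \<noteq> 0 \<longleftrightarrow> x \<noteq> wpt"
  by (auto simp: circ_def)

section \<open>Angle functions along positive paths\<close>

text \<open>Split at the midpoint \<open>u\<close>. The minimum over the left half cannot lie inside
  or at \<open>u\<close>, since smaller values occur just to the left, so it is attained at
  \<open>c\<close>; dually the maximum over the right half is attained at \<open>d\<close>.\<close>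

lemma strict_increase_of_local:
  fixes \<theta> :: "real \<Rightarrow> real"
  assumes "c < d" and cont: "continuous_on {c..d} \<theta>"
    and local: "\<And>u. u \<in> {c<..<d} \<Longrightarrow>
      \<exists>e>0. (\<forall>v\<in>{u-e..<u}. \<theta> v < \<theta> u) \<and> (\<forall>v\<in>{u<..u+e}. \<theta> u < \<theta> v)"
  shows "\<theta> c < \<theta> d"
proof -
  define u where "u = (c + d) / 2"
  have u: "c < u" "u < d" using \<open>c < d\<close> by (auto simp: u_def)
  obtain e where e: "e > 0" "\<forall>v\<in>{u-e..<u}. \<theta> v < \<theta> u" "\<forall>v\<in>{u<..u+e}. \<theta> u < \<theta> v"
    using local[of u] u by auto
  have "\<theta> c < \<theta> u"
  proof -
    have "continuous_on {c..u} \<theta>" using cont u by (auto intro: continuous_on_subset)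
    then obtain m where m: "m \<in> {c..u}" "\<forall>y\<in>{c..u}. \<theta> m \<le> \<theta> y"
      using continuous_attains_inf[of "{c..u}" \<theta>] u by auto
    have "max c (u - e) \<in> {c..u}" "\<theta> (max c (u - e)) < \<theta> u" using u e by auto
    then have "\<theta> m < \<theta> u" using m by fastforce
    moreover have "m = c"
    proof (rule ccontr)
      assume "m \<noteq> c"
      moreover have "m \<noteq> u" using \<open>\<theta> m < \<theta> u\<close> by auto
      ultimately have "c < m" "m < d" using m u by auto
      then obtain e' where e': "e' > 0" "\<forall>v\<in>{m-e'..<m}. \<theta> v < \<theta> m"
        using local[of m] by auto
      have "max c (m - e') \<in> {c..u}" "\<theta> (max c (m - e')) < \<theta> m"
        using e' m \<open>c < m\<close> by auto
      then show False using m by fastforce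
    qed
    ultimately show ?thesis by simp
  qed
  moreover have "\<theta> u < \<theta> d"
  proof -
    have "continuous_on {u..d} \<theta>" using cont u by (auto intro: continuous_on_subset)
    then obtain m where m: "m \<in> {u..d}" "\<forall>y\<in>{u..d}. \<theta> y \<le> \<theta> m"
      using continuous_attains_sup[of "{u..d}" \<theta>] u by auto
    have "min d (u + e) \<in> {u..d}" "\<theta> u < \<theta> (min d (u + e))" using u e by auto
    then have "\<theta> u < \<theta> m" using m by fastforce
    moreover have "m = d"
    proof (rule ccontr)
      assume "m \<noteq> d"
      moreover have "m \<noteq> u" using \<open>\<theta> u < \<theta> m\<close> by auto
      ultimately have "c < m" "m < d" using m u by auto
      then obtain e' where e': "e' > 0" "\<forall>v\<in>{m<..m+e'}. \<theta> m < \<theta> v"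
        using local[of m] by auto
      have "min d (m + e') \<in> {u..d}" "\<theta> m < \<theta> (min d (m + e'))"
        using e' m \<open>m < d\<close> by auto
      then show False using m by fastforce
    qed
    ultimately show ?thesis by simp
  qed
  ultimately show ?thesis by simp
qed

lemma cis_eq_1D: "cis x = 1 \<Longrightarrow> x / (2 * pi) \<in> \<int>"
proof -
  assume "cis x = 1"
  then have "cos x = 1" by (simp add: complex_eq_iff)
  then obtain n where "x = of_int n * (2 * pi)" using cos_one_2pi_int by auto
  then show ?thesis by simp
qed

text \<open>The difference of the two lifts, shifted by \<open>\<alpha>\<close> and divided by
  \<open>2 * pi\<close>, is continuous and integer valued, hence constant on the interval.\<close>

lemma lifts_differ_by_constant:
  fixes \<theta> \<theta>' :: "real \<Rightarrow> real"
  assumes "continuous_on {l..r} \<theta>" "continuous_on {l..r} \<theta>'"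
    and eq: "\<And>v. v \<in> {l..r} \<Longrightarrow> cis (\<theta> v) * cis \<alpha> = cis (\<theta>' v)"
    and "v \<in> {l..r}" "w \<in> {l..r}"
  shows "\<theta> v - \<theta> w = \<theta>' v - \<theta>' w"
proof -
  define g where "g = (\<lambda>v. (\<theta> v + \<alpha> - \<theta>' v) / (2 * pi))"
  have int: "g v \<in> \<int>" if "v \<in> {l..r}" for v
  proof -
    have "cis (\<theta> v + \<alpha> - \<theta>' v) = 1"
      using eq[OF that] by (simp add: cis_divide[symmetric] cis_mult[symmetric])
    then show ?thesis unfolding g_def by (rule cis_eq_1D)
  qed
  have "g constant_on {l..r}"
  proof (rule continuous_discrete_range_constant)
    show "continuous_on {l..r} g"
      unfolding g_def by (intro continuous_intros assms) auto
    fix x assume "x \<in> {l..r}"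
    then show "\<exists>e>0. \<forall>y. y \<in> {l..r} \<and> g y \<noteq> g x \<longrightarrow> e \<le> norm (g y - g x)"
      using int by (intro exI[of _ 1]) (auto intro!: Ints_nonzero_abs_ge1)
  qed auto
  then have "g v = g w" using assms(4,5) by (auto simp: constant_on_def)
  then show ?thesis by (simp add: g_def)
qed

text \<open>Measuring from the missed point \<open>z0\<close> keeps the branch cut of
  \<open>Arg2pi\<close> off the path, so the angle is continuous. Near an inner time it differs by a
  constant from the increasing lifts that \<open>pos_path\<close> supplies. The ends may sit at the
  wedge point, so local monotonicity is examined at inner times.\<close>

lemma pos_path_angle_increases:
  fixes \<gamma> :: "real \<Rightarrow> 'b \<Rightarrow> complex"
  assumes pos: "pos_path \<gamma> T" and sub: "{c<..<d} \<subseteq> T" and "c < d"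
    and cont: "continuous_on {c..d} (\<lambda>v. \<gamma> v a)"
    and circ: "\<And>v. v \<in> {c..d} \<Longrightarrow> \<gamma> v \<in> circ a"
    and nw: "\<And>v. v \<in> {c<..<d} \<Longrightarrow> \<gamma> v \<noteq> wpt"
    and z0: "cmod z0 = 1" and miss: "\<And>v. v \<in> {c..d} \<Longrightarrow> 1 + \<gamma> v a \<noteq> z0"
  shows "Arg2pi ((1 + \<gamma> c a) / z0) < Arg2pi ((1 + \<gamma> d a) / z0)"
proof -
  define \<theta> where "\<theta> = (\<lambda>v. Arg2pi ((1 + \<gamma> v a) / z0))"
  define \<alpha> where "\<alpha> = Arg2pi z0"
  have z0': "cis \<alpha> = z0" using z0 complex_norm_eq_1_exp[of z0] by (simp add: \<alpha>_def cis_conv_exp)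
  have nz: "z0 \<noteq> 0" using z0 by auto
  have n1: "cmod ((1 + \<gamma> v a) / z0) = 1" if "v \<in> {c..d}" for v
    using circ[OF that] z0 by (simp add: mem_circ_iff norm_divide)
  have cis: "cis (\<theta> v) * cis \<alpha> = 1 + \<gamma> v a" if "v \<in> {c..d}" for v
    using n1[OF that] complex_norm_eq_1_exp[of "(1 + \<gamma> v a) / z0"] nz
    by (simp add: \<theta>_def cis_conv_exp[symmetric] z0')
  have c\<theta>: "continuous_on {c..d} \<theta>"
    unfolding \<theta>_def
  proof (rule continuous_on_compose2[where t = "- \<real>\<^sub>\<ge>\<^sub>0" and g = Arg2pi])
    show "continuous_on (- \<real>\<^sub>\<ge>\<^sub>0) Arg2pi"
      by (auto intro!: continuous_at_imp_continuous_on continuous_at_Arg2pi)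
    show "continuous_on {c..d} (\<lambda>v. (1 + \<gamma> v a) / z0)"
      using nz by (intro continuous_intros cont) auto
    show "(\<lambda>v. (1 + \<gamma> v a) / z0) ` {c..d} \<subseteq> - \<real>\<^sub>\<ge>\<^sub>0"
    proof clarify
      fix v assume v: "v \<in> {c..d}" and "(1 + \<gamma> v a) / z0 \<in> \<real>\<^sub>\<ge>\<^sub>0"
      then obtain q where q: "(1 + \<gamma> v a) / z0 = of_real q" "q \<ge> 0"
        by (auto simp: nonneg_Reals_def)
      then have "q = 1" using n1[OF v] by simp
      then show False using q miss[OF v] nz by (simp add: field_simps)
    qed
  qed
  have "\<theta> c < \<theta> d"
  proof (rule strict_increase_of_local[OF \<open>c < d\<close> c\<theta>])
    fix u assume u: "u \<in> {c<..<d}"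
    then have "u \<in> T" using sub by auto
    with pos obtain \<epsilon> b \<theta>1 b' \<theta>2 where e: "\<epsilon> > 0"
      and 1: "continuous_on {u - \<epsilon>..u} \<theta>1" "strict_mono_on {u - \<epsilon>..u} \<theta>1"
         "\<forall>t\<in>{u - \<epsilon>..u}. \<gamma> t = emb b (cis (\<theta>1 t))"
      and 2: "continuous_on {u..u + \<epsilon>} \<theta>2" "strict_mono_on {u..u + \<epsilon>} \<theta>2"
         "\<forall>t\<in>{u..u + \<epsilon>}. \<gamma> t = emb b' (cis (\<theta>2 t))"
      unfolding pos_path_def by meson
    have nwu: "\<gamma> u \<noteq> wpt" using nw[OF u] .
    have ue: "\<gamma> u = emb a (1 + \<gamma> u a)" "1 + \<gamma> u a \<noteq> 1"
      using circ[of u] u nwu by (auto simp: mem_circ_iff circ_coord_neq_0)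
    have "\<gamma> u = emb b (cis (\<theta>1 u))" "\<gamma> u = emb b' (cis (\<theta>2 u))"
      using bspec[OF 1(3), of u] bspec[OF 2(3), of u] e by simp_all
    \<comment> \<open>The one-sided lifts could run on different circles only at the wedge point,
      and \<open>\<gamma> u\<close> is not there.\<close>
    with ue have ab: "b = a" "b' = a" by (metis emb_eqD(1))+
    define k where "k = min \<epsilon> (min (u - c) (d - u))"
    have k: "k > 0" "{u-k..u} \<subseteq> {c..d}" "{u..u+k} \<subseteq> {c..d}"
      "{u-k..u} \<subseteq> {u-\<epsilon>..u}" "{u..u+k} \<subseteq> {u..u+\<epsilon>}"
      using u e by (auto simp: k_def)
    have "\<theta> v < \<theta> u" if v: "v \<in> {u-k..<u}" for v
    proof -
      have "\<theta> v - \<theta> u = \<theta>1 v - \<theta>1 u"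
      proof (rule lifts_differ_by_constant[where l = "u - k" and r = u and \<alpha> = \<alpha>])
        show "continuous_on {u-k..u} \<theta>" "continuous_on {u-k..u} \<theta>1"
          using c\<theta> 1(1) k by (meson continuous_on_subset)+
        fix w assume w: "w \<in> {u-k..u}"
        then have "\<gamma> w = emb a (cis (\<theta>1 w))" using 1(3) k ab by blast
        then show "cis (\<theta> w) * cis \<alpha> = cis (\<theta>1 w)" using cis[of w] w k by auto
      qed (use v k in auto)
      moreover have "\<theta>1 v < \<theta>1 u" 
        using strict_mono_onD[OF 1(2), of v u] v k e by fastforce
      ultimately show ?thesis by simp
    qed
    moreover have "\<theta> u < \<theta> v" if v: "v \<in> {u<..u+k}" for v
    proof -
      have "\<theta> v - \<theta> u = \<theta>2 v - \<theta>2 u"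
      proof (rule lifts_differ_by_constant[where l = u and r = "u + k" and \<alpha> = \<alpha>])
        show "continuous_on {u..u+k} \<theta>" "continuous_on {u..u+k} \<theta>2"
          using c\<theta> 2(1) k by (meson continuous_on_subset)+
        fix w assume w: "w \<in> {u..u+k}"
        then have "\<gamma> w = emb a (cis (\<theta>2 w))" using 2(3) k ab by blast
        then show "cis (\<theta> w) * cis \<alpha> = cis (\<theta>2 w)" using cis[of w] w k by auto
      qed (use v k in auto)
      moreover have "\<theta>2 u < \<theta>2 v" 
        using strict_mono_onD[OF 2(2), of u v] v k e by fastforce
      ultimately show ?thesis by simp
    qed
    ultimately show "\<exists>e>0. (\<forall>v\<in>{u-e..<u}. \<theta> v < \<theta> u) \<and> (\<forall>v\<in>{u<..u+e}. \<theta> u < \<theta> v)"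
      using k(1) by blast
  qed
  then show ?thesis by (simp add: \<theta>_def)
qed

text \<open>If the excursion missed a point of the circle, the angle measured from that point would be
  a continuous function along the excursion that increases strictly and yet has equal end values.\<close>
lemma pos_path_covers_circ:
  fixes \<gamma> :: "real \<Rightarrow> 'b \<Rightarrow> complex"
  assumes "pos_path \<gamma> T" "{c<..<d} \<subseteq> T" "c < d"
    and "continuous_on {c..d} (\<lambda>v. \<gamma> v a)"
    and "\<gamma> c = wpt" "\<gamma> d = wpt"
    and inner: "\<And>v. v \<in> {c<..<d} \<Longrightarrow> \<gamma> v \<noteq> wpt \<and> \<gamma> v \<in> circ a"
  shows "circ a \<subseteq> \<gamma> ` {c..d}"
proof
  fix x assume x: "x \<in> circ a"
  have circ: "\<gamma> v \<in> circ a" if "v \<in> {c..d}" for v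
    using assms(5,6) inner[of v] that by (cases "v = c \<or> v = d") auto
  show "x \<in> \<gamma> ` {c..d}"
  proof (rule ccontr)
    assume n: "x \<notin> \<gamma> ` {c..d}"
    have "1 + \<gamma> v a \<noteq> 1 + x a" if "v \<in> {c..d}" for v
      using x circ[OF that] n that by (metis mem_circ_iff imageI)
    then have "Arg2pi ((1 + \<gamma> c a) / (1 + x a)) < Arg2pi ((1 + \<gamma> d a) / (1 + x a))"
      using assms(1-4) inner circ x
      by (intro pos_path_angle_increases[where T = T]) (auto simp: mem_circ_iff)
    then show False using assms(5,6) by simp
  qed
qed

section \<open>Images of paths and circles in a wedge\<close>

text \<open>The times at which coordinate \<open>a\<close> is nonzero and those at which another
  coordinate is nonzero form disjoint relatively open sets covering \<open>I\<close>; connectedness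
  empties the second.\<close>

lemma wedge_path_single_circ:
  fixes \<gamma> :: "real \<Rightarrow> 'b \<Rightarrow> complex"
  assumes I: "connected I" and cont: "continuous_on I \<gamma>"
    and wedge: "\<And>v. v \<in> I \<Longrightarrow> \<gamma> v \<in> wedge A" and nw: "\<And>v. v \<in> I \<Longrightarrow> \<gamma> v \<noteq> wpt"
    and "u \<in> I" "\<gamma> u \<in> circ a" "v \<in> I"
  shows "\<gamma> v \<in> circ a"
proof -
  have c: "continuous_on I (\<lambda>v. \<gamma> v b)" for b
    using cont by (rule continuous_on_product_then_coordinatewise)
  have op: "openin (top_of_set I) (I \<inter> (\<lambda>v. \<gamma> v b) -` (- {0}))" for b
    by (rule continuous_openin_preimage_gen[OF c]) auto
  define P where "P = I \<inter> (\<lambda>v. \<gamma> v a) -` (- {0})"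
  define Q where "Q = (\<Union>b\<in>-{a}. I \<inter> (\<lambda>v. \<gamma> v b) -` (- {0}))"
  have "openin (top_of_set I) P" "openin (top_of_set I) Q"
    unfolding P_def Q_def using op by (blast intro: openin_Union)+
  moreover have "I \<subseteq> P \<union> Q" using nw by (fastforce simp: P_def Q_def wpt_def)
  moreover have "P \<inter> Q = {}"
  proof -
    have False if "v \<in> I" "\<gamma> v a \<noteq> 0" "\<gamma> v b \<noteq> 0" "b \<noteq> a" for v b
    proof -
      have "\<gamma> v = emb a (1 + \<gamma> v a)"
        using wedge_coord(2)[OF wedge] that mem_circ_iff by metis
      then have "\<gamma> v b = 0" using that by (metis emb_def)
      then show False using that by simp
    qed
    then show ?thesis unfolding P_def Q_def by blast
  qed
  moreover have "P \<noteq> {}" using assms(5,6) nw by (auto simp: P_def circ_coord_neq_0)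
  ultimately have "Q = {}" using I unfolding connected_openin by blast
  then have "v \<in> P" using \<open>v \<in> I\<close> \<open>I \<subseteq> P \<union> Q\<close> by auto
  then show ?thesis using wedge_coord(2)[OF wedge] by (auto simp: P_def)
qed

text \<open>Each piece between consecutive break times is an excursion along the circle of one
  letter and therefore covers it; conversely every time is a break time or lies inside a
  piece.\<close>

lemma pos_path_circ_image:
  fixes \<gamma> :: "real \<Rightarrow> 'b \<Rightarrow> complex"
  assumes pos: "pos_path \<gamma> {0<..<2*pi}" and trav: "traverses \<gamma> w"
    and cont: "continuous_on {0..2*pi} \<gamma>" and wedge: "\<And>v. v \<in> {0..2*pi} \<Longrightarrow> \<gamma> v \<in> wedge A"
  shows "\<gamma> ` {0..2*pi} = (\<Union>a\<in>set w. circ a)"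
proof -
  obtain t :: "nat \<Rightarrow> real" where t: "t 0 = 0" "t (length w) = 2 * pi"
    "\<And>j. j < length w \<Longrightarrow> t j < t (Suc j)" "\<And>j. j \<le> length w \<Longrightarrow> \<gamma> (t j) = wpt"
    "\<And>j u. j < length w \<Longrightarrow> u \<in> {t j<..<t (Suc j)} \<Longrightarrow> \<gamma> u \<noteq> wpt \<and> (\<exists>z. \<gamma> u = emb (w ! j) z)"
    using trav unfolding traverses_def by metis
  have mono: "t i \<le> t j" if "i \<le> j" "j \<le> length w" for i j
    using that
  proof (induction j rule: dec_induct)
    case (step n)
    then show ?case using t(3)[of n] by simp
  qed simp
  have range: "{t j..t (Suc j)} \<subseteq> {0..2*pi}" if "j < length w" for j
    using mono[of 0 j] mono[of "Suc j" "length w"] that t by auto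
  have inner: "\<gamma> u \<noteq> wpt \<and> \<gamma> u \<in> circ (w ! j)" if j: "j < length w" and u: "u \<in> {t j<..<t (Suc j)}" for j u
  proof -
    \<comment> \<open>\<open>traverses\<close> leaves the modulus of \<open>z\<close> open; that the
      point really lies on the circle comes from membership in the wedge.\<close>
    obtain z where z: "\<gamma> u \<noteq> wpt" "\<gamma> u = emb (w ! j) z" using t(5)[OF j u] by auto
    then have "\<gamma> u (w ! j) \<noteq> 0" by auto
    moreover have "u \<in> {0..2*pi}" using range[OF j] u by auto
    ultimately show ?thesis using wedge_coord(2)[OF wedge] z by blast
  qed
  have ne: "w \<noteq> []" using t(1,2) by auto
  show ?thesis
  proof
    show "\<gamma> ` {0..2*pi} \<subseteq> (\<Union>a\<in>set w. circ a)"
    proof clarify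
      fix v assume v: "v \<in> {0..2*pi}"
      show "\<gamma> v \<in> (\<Union>a\<in>set w. circ a)"
      proof (cases "\<exists>j\<le>length w. v = t j")
        case True
        then show ?thesis using t(4) ne by (auto intro!: bexI[of _ "hd w"])
      next
        case False
        \<comment> \<open>The last break time not after \<open>v\<close> starts the piece that
          contains \<open>v\<close>.\<close>
        define j where "j = (GREATEST j. j \<le> length w \<and> t j \<le> v)"
        have ex: "0 \<le> length w \<and> t 0 \<le> v" using t(1) v by auto
        have j: "j \<le> length w" "t j \<le> v"
          using GreatestI_nat[of "\<lambda>j. j \<le> length w \<and> t j \<le> v" 0 "length w"] ex
          unfolding j_def by auto
        have "j \<noteq> length w" using j False t(2) v by auto
        then have jl: "j < length w" using j by simp
        have "\<not> t (Suc j) \<le> v"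
          using Greatest_le_nat[of "\<lambda>j. j \<le> length w \<and> t j \<le> v" "Suc j" "length w"] jl
          unfolding j_def[symmetric] by auto
        moreover have "t j \<noteq> v" using False j(1) by blast
        ultimately have "v \<in> {t j<..<t (Suc j)}" using j(2) by simp
        then show ?thesis using inner[OF jl] jl by (meson UN_I nth_mem)
      qed
    qed
    show "(\<Union>a\<in>set w. circ a) \<subseteq> \<gamma> ` {0..2*pi}"
    proof clarify
      fix a x assume "a \<in> set w" "x \<in> circ a"
      then obtain j where j: "j < length w" "w ! j = a" by (auto simp: in_set_conv_nth)
      have "circ a \<subseteq> \<gamma> ` {t j..t (Suc j)}"
      proof (rule pos_path_covers_circ[OF pos])
        show "{t j<..<t (Suc j)} \<subseteq> {0<..<2*pi}" using range[OF j(1)] t(3)[OF j(1)] by auto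
        show "continuous_on {t j..t (Suc j)} (\<lambda>v. \<gamma> v a)"
          using range[OF j(1)]
          by (rule continuous_on_product_then_coordinatewise[OF continuous_on_subset[OF cont]])
      qed (use t inner j in auto)
      then show "x \<in> \<gamma> ` {0..2*pi}" using range[OF j(1)] \<open>x \<in> circ a\<close> by blast
    qed
  qed
qed

lemma circ_eq_cis_image: "circ a = (\<lambda>t. emb a (cis t)) ` {0..2*pi}"
proof -
  have "z \<in> cis ` {0..2*pi}" if "cmod z = 1" for z
    using complex_norm_eq_1_exp[of z] that Arg2pi[of z]
    by (intro image_eqI[of _ _ "Arg2pi z"]) (auto simp: cis_conv_exp)
  then have "sphere 0 1 = cis ` {0..2*pi}" by auto
  then show ?thesis unfolding circ_def by (simp add: image_image)
qed

lemma continuous_on_emb_cis: "continuous_on I (\<lambda>t. emb a (cis t))"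
proof (rule continuous_on_coordinatewise_then_product)
  fix c
  show "continuous_on I (\<lambda>t. emb a (cis t) c)"
    by (cases "c = a") (auto simp: emb_def intro!: continuous_intros)
qed

text \<open>Parametrising circle \<open>b\<close> by \<open>cis\<close> over
  \<open>{0..2*pi}\<close> reduces this to the statement on paths.\<close>

lemma pos_map_circ_image:
  assumes "pos_map B A f" "b \<in> B" "traverses (\<lambda>t. f (emb b (cis t))) w"
  shows "f ` circ b = (\<Union>a\<in>set w. circ a)"
proof -
  have sub: "(\<lambda>t. emb b (cis t)) ` {0..2*pi} \<subseteq> wedge B"
    using assms(2) by (force simp: wedge_def)
  have "(\<lambda>t. f (emb b (cis t))) ` {0..2*pi} = (\<Union>a\<in>set w. circ a)"
  proof (rule pos_path_circ_image[OF _ assms(3)])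
    show "pos_path (\<lambda>t. f (emb b (cis t))) {0<..<2*pi}"
      using assms(1,2) by (simp add: pos_map_def)
    show "continuous_on {0..2*pi} (\<lambda>t. f (emb b (cis t)))"
      using assms(1) sub
      by (intro continuous_on_compose2[OF _ continuous_on_emb_cis]) (auto simp: pos_map_def)
    show "f (emb b (cis v)) \<in> wedge A" if "v \<in> {0..2*pi}" for v
      using assms(1) sub that unfolding pos_map_def by blast
  qed
  then show ?thesis unfolding circ_eq_cis_image[of b] by (simp add: image_image)
qed

section \<open>Expansions of flow spaces and composed bonding maps\<close>

text \<open>The composite of \<open>f n\<close>, ..., \<open>f (n + k - 1)\<close>, from level
  \<open>n + k\<close> down to level \<open>n\<close>. The map from the highest level is split off,
  as in \<open>symcomp\<close>, so that both recursions run in parallel.\<close>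

primrec bonding :: "(nat \<Rightarrow> 'c \<Rightarrow> 'c) \<Rightarrow> nat \<Rightarrow> nat \<Rightarrow> 'c \<Rightarrow> 'c" where
  "bonding f n 0 = (\<lambda>x. x)"
| "bonding f n (Suc k) = (\<lambda>x. bonding f n k (f (n + k) x))"

text \<open>One fixed expansion witnessing \<open>represents\<close>. The homeomorphism onto the
  inverse limit is recorded as \<open>inj_p\<close>: the projections separate points.\<close>

locale flow_expansion =
  fixes X :: "'a::metric_space set" and \<phi> :: "real \<Rightarrow> 'a \<Rightarrow> 'a"
    and A :: "nat \<Rightarrow> 'b set" and s :: "nat \<Rightarrow> 'b \<Rightarrow> 'b list"
    and f :: "nat \<Rightarrow> ('b \<Rightarrow> complex) \<Rightarrow> 'b \<Rightarrow> complex"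
    and p :: "nat \<Rightarrow> 'a \<Rightarrow> 'b \<Rightarrow> complex" and x0 :: 'a
  assumes flow: "flow_space X \<phi>" and symb: "symbolic_seq A s"
    and x0: "x0 \<in> X" "p i x0 = wpt"
    and f: "pos_map (A (Suc i)) (A i) (f i)"
    and cont_p: "continuous_on X (p i)" and surj_p: "p i ` X = wedge (A i)"
    and pos_p: "x \<in> X \<Longrightarrow> pos_path (\<lambda>t. p i (\<phi> t x)) UNIV"
    and p_eq_f: "x \<in> X \<Longrightarrow> p i x = f i (p (Suc i) x)"
    and inj_p: "inj_on (\<lambda>x i. p i x) X"
    and trav: "b \<in> A (Suc i) \<Longrightarrow> traverses (\<lambda>t. f i (emb b (cis t))) (s i b)"
begin

lemma compact_X: "compact X"
  and flow_in [simp]: "x \<in> X \<Longrightarrow> \<phi> t x \<in> X"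
  and cont_flow2: "continuous_on (UNIV \<times> X) (\<lambda>(t, x). \<phi> t x)"
  and flow_0 [simp]: "x \<in> X \<Longrightarrow> \<phi> 0 x = x"
  and flow_add: "x \<in> X \<Longrightarrow> \<phi> t (\<phi> u x) = \<phi> (t + u) x"
  using flow by (auto simp: flow_space_def)

lemma p_in [simp]: "x \<in> X \<Longrightarrow> p i x \<in> wedge (A i)"
  using surj_p by blast

lemma cont_flow: "x \<in> X \<Longrightarrow> continuous_on I (\<lambda>t. \<phi> t x)"
  using continuous_on_compose2[OF cont_flow2, of I "\<lambda>t. (t, x)"]
    continuous_on_Pair[OF continuous_on_id continuous_on_const]
  by auto

lemma cont_orbit_p: "x \<in> X \<Longrightarrow> continuous_on I (\<lambda>t. p i (\<phi> t x))"
  by (rule continuous_on_compose2[OF cont_p cont_flow]) auto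

lemma flow_tendsto:
  assumes "(t \<longlongrightarrow> t') F" "(x \<longlongrightarrow> x') F" "\<And>j. x j \<in> X" "x' \<in> X"
  shows "((\<lambda>j. \<phi> (t j) (x j)) \<longlongrightarrow> \<phi> t' x') F"
  using continuous_on_tendsto_compose[OF cont_flow2, of "\<lambda>j. (t j, x j)" "(t', x')" F]
    assms tendsto_Pair[OF assms(1,2)] by auto

lemma p_tendsto:
  assumes "(x \<longlongrightarrow> x') F" "\<And>j. x j \<in> X" "x' \<in> X"
  shows "((\<lambda>j. p i (x j) a) \<longlongrightarrow> p i x' a) F"
  using continuous_on_tendsto_compose[OF continuous_on_product_then_coordinatewise[OF cont_p] assms(1)]
    assms by auto

lemma eq_if_projections_eq: "x \<in> X \<Longrightarrow> y \<in> X \<Longrightarrow> (\<And>i. p i x = p i y) \<Longrightarrow> x = y"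
  using inj_p by (auto simp: inj_on_def)

lemma letters_in: "b \<in> A (Suc i) \<Longrightarrow> set (s i b) \<subseteq> A i"
  using symb by (auto simp: symbolic_seq_def)

lemma finite_A: "finite (A i)"
  using symb by (auto simp: symbolic_seq_def)

lemma p_eq_bonding: "x \<in> X \<Longrightarrow> p n x = bonding f n k (p (n + k) x)"
  by (induction k) (auto simp flip: p_eq_f)

lemma bonding_wpt [simp]: "bonding f n k wpt = wpt"
  using f by (induction k) (auto simp: pos_map_def)

lemma p_wpt_mono: "x \<in> X \<Longrightarrow> n \<le> m \<Longrightarrow> p m x = wpt \<Longrightarrow> p n x = wpt"
  using p_eq_bonding[of x n "m - n"] by simp

lemma p_eq_mono: "x \<in> X \<Longrightarrow> y \<in> X \<Longrightarrow> n \<le> m \<Longrightarrow> p m x = p m y \<Longrightarrow> p n x = p n y"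
  using p_eq_bonding[of x n "m - n"] p_eq_bonding[of y n "m - n"] by simp

text \<open>The bridge from topology to words: the map from the highest level spreads the circle
  over the letters of its word, and the induction hypothesis treats each letter.\<close>

lemma bonding_circ_image:
  "c \<in> A (n + k) \<Longrightarrow> bonding f n k ` circ c = (\<Union>a\<in>set (symcomp s n k c). circ a)"
proof (induction k arbitrary: c)
  case (Suc k)
  have "bonding f n (Suc k) ` circ c = bonding f n k ` (f (n + k) ` circ c)"
    by (simp add: image_image)
  also have "f (n + k) ` circ c = (\<Union>b\<in>set (s (n + k) c). circ b)"
    using Suc.prems f trav by (intro pos_map_circ_image[of "A (Suc (n + k))"]) auto
  also have "bonding f n k ` \<dots> = (\<Union>b\<in>set (s (n + k) c). bonding f n k ` circ b)"
    by blast
  also have "\<dots> = (\<Union>b\<in>set (s (n + k) c). \<Union>a\<in>set (symcomp s n k b). circ a)"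
    using letters_in[of c "n + k"] Suc.prems by (intro SUP_cong refl Suc.IH) auto
  finally show ?case by simp
qed simp

text \<open>Agreement at level \<open>j\<close> descends to all lower levels, so at a fixed level
  the projections of \<open>z j\<close> are eventually constant and determine that of the
  limit.\<close>

lemma tendsto_eqI:
  assumes "z \<longlonglongrightarrow> z'" "\<And>j. z j \<in> X" "z' \<in> X" "y \<in> X" "\<And>j. p j (z j) = p j y"
  shows "z' = y"
proof (rule eq_if_projections_eq[OF assms(3,4)], rule ext)
  fix i a
  have "\<forall>\<^sub>F j in sequentially. p i (z j) a = p i y a"
    using eventually_ge_at_top[of i] by eventually_elim (use p_eq_mono assms in metis)
  then have "(\<lambda>j. p i (z j) a) \<longlonglongrightarrow> p i y a"
    by (rule tendsto_eventually)
  with p_tendsto[OF assms(1-3)] show "p i z' a = p i y a"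
    using LIMSEQ_unique by blast
qed

section \<open>Passages of orbits over the wedge point\<close>

text \<open>Local injectivity keeps the path off the wedge point just after \<open>c\<close>, so
  there is a first return time \<open>r\<close>. Until then the path stays on one circle, and it
  covers this circle.\<close>

lemma excursion_covers_circ:
  assumes x: "x \<in> X" and "c < d" and zeros: "p m (\<phi> c x) = wpt" "p m (\<phi> d x) = wpt"
  obtains a where "a \<in> A m" "circ a \<subseteq> (\<lambda>t. p m (\<phi> t x)) ` {c..d}"
proof -
  define \<gamma> where "\<gamma> = (\<lambda>t. p m (\<phi> t x))"
  have pos: "pos_path \<gamma> UNIV" and cont: "\<And>I. continuous_on I \<gamma>"
    and wed: "\<And>t. \<gamma> t \<in> wedge (A m)"
    using pos_p cont_orbit_p x by (auto simp: \<gamma>_def)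
  obtain e where e: "e > 0" "inj_on \<gamma> {c - e..c + e}"
    using pos unfolding pos_path_def by blast
  have nz: "\<gamma> t \<noteq> wpt" if "c < t" "t \<le> c + e" for t
    using inj_onD[OF e(2), of t c] that zeros e by (auto simp: \<gamma>_def)
  define Z where "Z = {t\<in>{c + e..d}. \<gamma> t = wpt}"
  have "Z = (\<Inter>b. {t\<in>{c + e..d}. \<gamma> t b = 0})" by (auto simp: Z_def wpt_def)
  then have "closed Z"
    by (simp only:) (intro closed_INT ballI continuous_closed_preimage_constant
        continuous_on_product_then_coordinatewise[OF cont] closed_real_atLeastAtMost)
  moreover have "bounded Z" by (rule bounded_subset[of "{c + e..d}"]) (auto simp: Z_def)
  moreover have "d \<in> Z" using zeros \<open>c < d\<close> nz[of d] by (force simp: Z_def \<gamma>_def)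
  ultimately obtain r where r: "r \<in> Z" "\<And>t. t \<in> Z \<Longrightarrow> r \<le> t"
    using compact_attains_inf[of Z] compact_eq_bounded_closed by blast
  have cr: "c < r" "r \<le> d" "\<gamma> r = wpt" using r e by (auto simp: Z_def)
  have free: "\<gamma> t \<noteq> wpt" if "t \<in> {c<..<r}" for t
    using nz[of t] r(2)[of t] that cr by (fastforce simp: Z_def)
  define u where "u = (c + r) / 2"
  have u: "u \<in> {c<..<r}" using cr by (auto simp: u_def)
  obtain a where a: "a \<in> A m" "\<gamma> u \<in> circ a"
    using wedge_obtain_circ[OF wed free[OF u]] by metis
  have "circ a \<subseteq> \<gamma> ` {c..r}"
  proof (rule pos_path_covers_circ[OF pos])
    show "continuous_on {c..r} (\<lambda>v. \<gamma> v a)"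
      by (rule continuous_on_product_then_coordinatewise[OF cont])
    fix v assume v: "v \<in> {c<..<r}"
    show "\<gamma> v \<noteq> wpt \<and> \<gamma> v \<in> circ a"
      using free v wedge_path_single_circ[OF _ cont wed _ u a(2) v] by auto
  qed (use cr zeros in \<open>auto simp: \<gamma>_def\<close>)
  then show ?thesis using that[OF a(1)] cr unfolding \<gamma>_def by fastforce
qed

text \<open>Otherwise the orbit would eventually run along one circle with a convergent angle,
  and at an \<open>\<omega>\<close>-limit point the flow would be invisible in the projection.\<close>
lemma orbit_hits_wedge_point:
  assumes x: "x \<in> X"
  obtains t where "t > T" "p m (\<phi> t x) = wpt"
proof (rule ccontr)
  assume "\<not> thesis"
  then have nz: "\<And>t. t > T \<Longrightarrow> p m (\<phi> t x) \<noteq> wpt" using that by blast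
  define \<gamma> where "\<gamma> = (\<lambda>t. p m (\<phi> t x))"
  have pos: "pos_path \<gamma> UNIV" and cont: "\<And>I. continuous_on I \<gamma>"
    and wed: "\<And>t. \<gamma> t \<in> wedge (A m)"
    using pos_p cont_orbit_p x by (auto simp: \<gamma>_def)
  define S where "S = T + 1"
  have free: "\<gamma> t \<noteq> wpt" if "t \<in> {S..}" for t using nz that by (auto simp: \<gamma>_def S_def)
  obtain a where a: "a \<in> A m" "\<gamma> S \<in> circ a"
    using wedge_obtain_circ[OF wed free[of S]] by auto
  have circ: "\<gamma> t \<in> circ a" if "t \<ge> S" for t
    using wedge_path_single_circ[of "{S..}", OF _ cont wed free _ a(2), of t] that by auto
  \<comment> \<open>Here the missed point is the wedge point itself, with parameter 1.\<close>
  define \<theta> where "\<theta> = (\<lambda>t. Arg2pi (1 + \<gamma> t a))"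
  have less: "\<theta> c < \<theta> d" if "S \<le> c" "c < d" for c d
    using pos_path_angle_increases[OF pos _ \<open>c < d\<close>
      continuous_on_product_then_coordinatewise[OF cont], of a 1] circ free that
    by (auto simp: \<theta>_def circ_coord_neq_0)
  have cis: "\<gamma> t a = cis (\<theta> t) - 1" if "t \<ge> S" for t
    using circ[OF that] complex_norm_eq_1_exp[of "1 + \<gamma> t a"]
    by (simp add: mem_circ_iff \<theta>_def cis_conv_exp)
  have "incseq (\<lambda>j. \<theta> (S + real j))"
    by (rule incseq_SucI, rule less_imp_le, rule less) auto
  moreover have "\<And>j. \<theta> (S + real j) \<le> 2 * pi" using Arg2pi by (auto simp: \<theta>_def less_imp_le)
  ultimately obtain L where L: "(\<lambda>j. \<theta> (S + real j)) \<longlonglongrightarrow> L"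
    using incseq_convergent[of "\<lambda>j. \<theta> (S + real j)"] by metis
  obtain y r where y: "y \<in> X" "strict_mono r" "(\<lambda>j. \<phi> (S + real (r j)) x) \<longlonglongrightarrow> y"
    using compact_X[unfolded compact_def, rule_format, of "\<lambda>j. \<phi> (S + real j) x"] x
    by (auto simp: o_def)
  \<comment> \<open>The right-hand side is \<open>emb a (cis L)\<close>, independent of
    \<open>u\<close>.\<close>
  have const: "p m (\<phi> u y) = (\<lambda>b. if b = a then cis L - 1 else 0)" if u: "u \<in> {0..1}" for u
  proof
    fix b
    have 1: "(\<lambda>j. p m (\<phi> u (\<phi> (S + real (r j)) x)) b) \<longlonglongrightarrow> p m (\<phi> u y) b"
      using x y by (intro p_tendsto flow_tendsto) auto
    \<comment> \<open>By monotonicity the angle at offset \<open>u\<close> lies between those at the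
      integer steps \<open>j\<close> and \<open>Suc j\<close>, both tending to
      \<open>L\<close>.\<close>
    have "(\<lambda>j. \<theta> (S + real j + u)) \<longlonglongrightarrow> L"
    proof (rule tendsto_sandwich[OF _ _ L LIMSEQ_Suc[OF L]])
      have "\<theta> (S + real j) \<le> \<theta> (S + real j + u)" for j
        using less[of "S + real j" "S + real j + u"] u by (cases "u = 0") auto
      then show "\<forall>\<^sub>F j in sequentially. \<theta> (S + real j) \<le> \<theta> (S + real j + u)" by simp
      have "\<theta> (S + real j + u) \<le> \<theta> (S + real (Suc j))" for j
        using less[of "S + real j + u" "S + real (Suc j)"] u
        by (cases "u = 1") (auto simp: algebra_simps)
      then show "\<forall>\<^sub>F j in sequentially. \<theta> (S + real j + u) \<le> \<theta> (S + real (Suc j))" by simp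
    qed
    then have "(\<lambda>j. \<theta> (S + real (r j) + u)) \<longlonglongrightarrow> L"
      using LIMSEQ_subseq_LIMSEQ[OF _ y(2)] by (force simp: o_def)
    then have 2: "(\<lambda>j. if b = a then cis (\<theta> (S + real (r j) + u)) - 1 else 0)
        \<longlonglongrightarrow> (if b = a then cis L - 1 else 0)"
      by (auto intro!: tendsto_intros)
    have "p m (\<phi> u (\<phi> (S + real (r j)) x)) b =
        (if b = a then cis (\<theta> (S + real (r j) + u)) - 1 else 0)" for j
    proof -
      define t where "t = S + real (r j) + u"
      have "S \<le> t" using u by (auto simp: t_def)
      moreover have "p m (\<phi> u (\<phi> (S + real (r j)) x)) = \<gamma> t"
        using x by (simp add: \<gamma>_def t_def flow_add algebra_simps)
      moreover have "\<gamma> t b = (if b = a then \<gamma> t a else 0)"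
        using circ[OF \<open>S \<le> t\<close>] by (auto simp: circ_def emb_def)
      ultimately show ?thesis using cis[of t] by (simp add: t_def)
    qed
    then show "p m (\<phi> u y) b = (if b = a then cis L - 1 else 0)"
      using 1 2 by (simp only: LIMSEQ_unique)
  qed
  obtain e where e: "e > 0" "inj_on (\<lambda>t. p m (\<phi> t y)) {0 - e..0 + e}"
    using pos_p[OF y(1), of m] unfolding pos_path_def by blast
  have "p m (\<phi> 0 y) = p m (\<phi> (min 1 e) y)"
    using const[of 0] const[of "min 1 e"] e by simp
  then have "0 = min 1 e" using e(1) by (intro inj_onD[OF e(2)]) auto
  then show False using e(1) by simp
qed

section \<open>From primitivity to minimality\<close>

lemma primitive_imp_minimal:
  assumes prim: "primitive_seq A s"
  shows "minimal_flow X \<phi>"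
  unfolding minimal_flow_def
proof (intro ballI subsetI)
  fix x y assume x: "x \<in> X" and y: "y \<in> X"
  \<comment> \<open>It suffices to match \<open>y\<close> at each level separately; compactness then
    makes the matching orbit points converge to \<open>y\<close> along a subsequence.\<close>
  have "\<exists>t. p n (\<phi> t x) = p n y" for n
  proof -
    obtain m where m: "m > n" "primitive_map (A m) (A n) (symcomp s n (m - n))"
      using prim by (auto simp: primitive_seq_def)
    obtain c where c: "p m (\<phi> c x) = wpt"
      using orbit_hits_wedge_point[OF x] by metis
    obtain d where d: "d > c" "p m (\<phi> d x) = wpt"
      using orbit_hits_wedge_point[OF x] by metis
    obtain b where b: "b \<in> A m" "circ b \<subseteq> (\<lambda>t. p m (\<phi> t x)) ` {c..d}"
      using excursion_covers_circ[OF x d(1) c d(2)] by metis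
    have im: "bonding f n (m - n) ` circ b = (\<Union>a\<in>set (symcomp s n (m - n) b). circ a)"
      using bonding_circ_image[of b n "m - n"] b m by simp
    have "p n y \<in> bonding f n (m - n) ` circ b"
    proof (cases "p n y = wpt")
      case True
      then show ?thesis by (metis bonding_wpt imageI wpt_in_circ)
    next
      case False
      then obtain a where "a \<in> A n" "p n y \<in> circ a"
        using wedge_obtain_circ[OF p_in[OF y]] by metis
      then show ?thesis unfolding im using m(2) b(1) by (auto simp: primitive_map_def)
    qed
    then obtain t where "p n y = bonding f n (m - n) (p m (\<phi> t x))" using b(2) by auto
    then show ?thesis using p_eq_bonding[of "\<phi> t x" n "m - n"] x m(1) by auto
  qed
  then obtain t where t: "\<And>n. p n (\<phi> (t n) x) = p n y" by metis
  obtain z r where z: "z \<in> X" "strict_mono r" "(\<lambda>j. \<phi> (t (r j)) x) \<longlonglongrightarrow> z"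
    using compact_X[unfolded compact_def, rule_format, of "\<lambda>j. \<phi> (t j) x"] x
    by (auto simp: o_def)
  have "z = y"
  proof (rule tendsto_eqI[OF z(3) _ z(1) y])
    \<comment> \<open>The match holds at level \<open>r j\<close>, and \<open>j \<le> r j\<close>
      lets it descend to level \<open>j\<close>.\<close>
    show "p j (\<phi> (t (r j)) x) = p j y" for j
      using p_eq_mono[OF _ y seq_suble[OF z(2)] t, of j] x by simp
  qed (use x in simp)
  then show "y \<in> closure (orbit \<phi> x)"
    using z(3) unfolding closure_sequential orbit_def
    by (intro exI[of _ "\<lambda>j. \<phi> (t (r j)) x"]) auto
qed

section \<open>Periodic orbits and return times\<close>

text \<open>Local injectivity at time 0 excludes small periods, so a least positive period
  \<open>r\<close> exists; running the orbit over one such period gives a simple closed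
  path.\<close>

lemma periodic_orbit_homeomorphic_circle:
  assumes x: "x \<in> X" and "\<tau> > 0" "\<phi> \<tau> x = x"
  shows "orbit \<phi> x homeomorphic sphere (0::complex) 1"
proof -
  obtain e where e: "e > 0" "inj_on (\<lambda>t. p 0 (\<phi> t x)) {0 - e..0 + e}"
    using pos_p[OF x, of 0] unfolding pos_path_def by blast
  have small: "\<phi> t x \<noteq> x" if "0 < t" "t \<le> e" for t
    using inj_onD[OF e(2), of t 0] that x by auto
  define Z where "Z = {t\<in>{e..\<tau>}. \<phi> t x = x}"
  have "closed Z"
    unfolding Z_def by (rule continuous_closed_preimage_constant[OF cont_flow[OF x]]) simp
  moreover have "bounded Z" by (rule bounded_subset[of "{e..\<tau>}"]) (auto simp: Z_def)
  moreover have "\<tau> \<in> Z" using assms small[of \<tau>] by (force simp: Z_def)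
  ultimately obtain r where r: "r \<in> Z" "\<And>t. t \<in> Z \<Longrightarrow> r \<le> t"
    using compact_attains_inf[of Z] compact_eq_bounded_closed by blast
  have r0: "0 < r" "r \<le> \<tau>" "\<phi> r x = x" using r e by (auto simp: Z_def)
  have least: "r \<le> t" if "0 < t" "\<phi> t x = x" for t
    using small[of t] r(2)[of t] that r0 by (fastforce simp: Z_def)
  have nat: "\<phi> (real k * r) x = x" for k
  proof (induction k)
    case (Suc k)
    have "\<phi> (real (Suc k) * r) x = \<phi> (real k * r) (\<phi> r x)"
      using x by (simp add: flow_add algebra_simps)
    then show ?case using Suc r0 by simp
  qed (use x in simp)
  have neg: "\<phi> (- (real k * r)) x = x" for k
    using flow_add[OF x, of "- (real k * r)" "real k * r"] nat[of k] x by simp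
  have int: "\<phi> (of_int k * r) x = x" for k :: int
    using nat neg by (cases k rule: int_cases2) auto
  define g where "g = (\<lambda>t. \<phi> (r * t) x)"
  have "path g"
    unfolding path_def g_def
    by (rule continuous_on_compose2[OF cont_flow[OF x, of UNIV]]) (auto intro!: continuous_intros)
  moreover have "loop_free g"
  proof -
    have *: "u = 0 \<and> v = 1" if "u \<in> {0..1}" "v \<in> {0..1}" "g u = g v" "u < v" for u v
    proof -
      \<comment> \<open>Equal values of \<open>g\<close> make the time difference a period, which is
        at least \<open>r\<close>.\<close>
      have "\<phi> (r * (v - u)) x = \<phi> (- r * u) (g v)"
        using x by (simp add: g_def flow_add algebra_simps)
      also have "\<dots> = x" using x by (simp add: that(3)[symmetric]) (simp add: g_def flow_add)
      finally have "r \<le> r * (v - u)" using least[of "r * (v - u)"] r0 that by simp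
      then have "1 \<le> v - u" using r0 by simp
      then show ?thesis using that by simp
    qed
    show ?thesis
      unfolding loop_free_def by (metis * linorder_less_linear)
  qed
  moreover have "pathfinish g = pathstart g"
    using r0 x by (simp add: pathfinish_def pathstart_def g_def)
  moreover have "path_image g = orbit \<phi> x"
  proof -
    have "\<phi> t x \<in> g ` {0..1}" for t
    proof -
      have "\<phi> t x = \<phi> (r * frac (t / r) + of_int \<lfloor>t / r\<rfloor> * r) x"
        using r0 by (simp add: frac_def algebra_simps)
      also have "\<dots> = g (frac (t / r))"
        using flow_add[OF x, of "r * frac (t / r)" "of_int \<lfloor>t / r\<rfloor> * r"] int by (simp add: g_def)
      finally show ?thesis using frac_lt_1[of "t / r"] by (simp add: less_imp_le)
    qed
    then show ?thesis by (auto simp: path_image_def orbit_def g_def)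
  qed
  ultimately show ?thesis
    using homeomorphic_simple_path_image_circle[of g 1 0] by (simp add: simple_path_def)
qed

text \<open>Points over the wedge points of ever higher levels converge to the base point, so bounded
  return times accumulate at a period of the base point, hence at \<open>0\<close>; but a return along
  the orbit passes through some \<open>emb a (-1)\<close>, away from the wedge point.\<close>
lemma return_times_unbounded:
  assumes "aperiodic_flow X \<phi>"
  obtains N where "\<And>m x \<tau>. \<lbrakk>m \<ge> N; x \<in> X; p m x = wpt; 0 < \<tau>; \<tau> \<le> T\<rbrakk> \<Longrightarrow> p m (\<phi> \<tau> x) \<noteq> wpt"
proof (rule ccontr)
  assume "\<not> thesis"
  \<comment> \<open>A failure at some level \<open>m \<ge> N\<close> is also one at level
    \<open>N\<close>, because points over the wedge point stay over it at lower levels.\<close>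
  then have "\<exists>x \<tau>. x \<in> X \<and> p N x = wpt \<and> 0 < \<tau> \<and> \<tau> \<le> T \<and> p N (\<phi> \<tau> x) = wpt" for N
    using that[of N] p_wpt_mono[of _ N] flow_in by metis
  then obtain x \<tau> where x\<tau>: "\<And>j. x j \<in> X" "\<And>j. p j (x j) = wpt"
      "\<And>j. 0 < \<tau> j" "\<And>j. \<tau> j \<le> T" "\<And>j. p j (\<phi> (\<tau> j) (x j)) = wpt"
    by metis
  have compact_strip: "compact ({0..T} \<times> X)" by (intro compact_Times compact_X) simp
  have "\<exists>l\<in>{0..T} \<times> X. \<exists>r::nat \<Rightarrow> nat. strict_mono r \<and> ((\<lambda>j. (\<tau> j, x j)) \<circ> r) \<longlonglongrightarrow> l"
    by (rule compact_strip[unfolded compact_def, rule_format]) (use x\<tau> in \<open>simp add: less_imp_le\<close>)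
  then obtain l r where l: "l \<in> {0..T} \<times> X" "strict_mono r"
      "(\<lambda>j. (\<tau> (r j), x (r j))) \<longlonglongrightarrow> l"
    unfolding o_def by blast
  obtain \<tau>' z where lz: "l = (\<tau>', z)" by (cases l)
  have \<tau>': "\<tau>' \<ge> 0" "(\<lambda>j. \<tau> (r j)) \<longlonglongrightarrow> \<tau>'" and z: "z \<in> X" "(\<lambda>j. x (r j)) \<longlonglongrightarrow> z"
    using l lz tendsto_fst[OF l(3)] tendsto_snd[OF l(3)] by auto
  have "z = x0"
    using x\<tau> x0 z p_wpt_mono[OF _ seq_suble[OF l(2)]]
    by (intro tendsto_eqI[of "\<lambda>j. x (r j)"]) auto
  have "\<phi> \<tau>' z = x0"
    using x\<tau> x0 z p_wpt_mono[OF _ seq_suble[OF l(2)]] \<tau>'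
    by (intro tendsto_eqI[of "\<lambda>j. \<phi> (\<tau> (r j)) (x (r j))"] flow_tendsto) auto
  then have "\<tau>' = 0"
    using periodic_orbit_homeomorphic_circle[of x0 \<tau>'] \<open>z = x0\<close> x0 assms \<tau>'(1)
    by (force simp: aperiodic_flow_def)
  \<comment> \<open>Level 0 suffices: both ends of the return lie over its wedge point, so the path
    between them covers a whole circle, including its antipodal point.\<close>
  have "\<exists>t a. 0 \<le> t \<and> t \<le> \<tau> j \<and> a \<in> A 0 \<and> p 0 (\<phi> t (x j)) = emb a (-1)" for j
  proof -
    have "p 0 (\<phi> 0 (x j)) = wpt" "p 0 (\<phi> (\<tau> j) (x j)) = wpt"
      using x\<tau> p_wpt_mono[of _ 0 j] by auto
    then obtain a where a: "a \<in> A 0" "circ a \<subseteq> (\<lambda>t. p 0 (\<phi> t (x j))) ` {0..\<tau> j}"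
      using excursion_covers_circ[OF x\<tau>(1) x\<tau>(3)] by metis
    moreover have "emb a (-1) \<in> circ a" by (simp add: circ_def)
    ultimately have "emb a (-1) \<in> (\<lambda>t. p 0 (\<phi> t (x j))) ` {0..\<tau> j}" by blast
    then obtain t where "t \<in> {0..\<tau> j}" "emb a (-1) = p 0 (\<phi> t (x j))" by (rule imageE)
    then show ?thesis using a(1) by (intro exI[of _ t] exI[of _ a]) simp
  qed
  then obtain t a where ta: "\<And>j. 0 \<le> t j" "\<And>j. t j \<le> \<tau> j" "\<And>j. a j \<in> A 0"
      "\<And>j. p 0 (\<phi> (t j) (x j)) = emb (a j) (-1)"
    by metis
  have "(\<lambda>j. t (r j)) \<longlonglongrightarrow> 0"
    by (rule tendsto_sandwich[OF _ _ tendsto_const \<tau>'(2)[unfolded \<open>\<tau>' = 0\<close>]]) (use ta in auto)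
  then have "(\<lambda>j. p 0 (\<phi> (t (r j)) (x (r j))) b) \<longlonglongrightarrow> p 0 (\<phi> 0 x0) b" for b
    using z x\<tau> x0 \<open>z = x0\<close> by (intro p_tendsto flow_tendsto) auto
  then have "(\<lambda>j. p 0 (\<phi> (t (r j)) (x (r j))) b) \<longlonglongrightarrow> 0" for b
    using x0 by (simp add: wpt_def)
  \<comment> \<open>The letter \<open>a j\<close> may vary with \<open>j\<close>; finiteness of
    \<open>A 0\<close> makes the estimate uniform in the letter.\<close>
  then have "\<forall>b\<in>A 0. \<forall>\<^sub>F j in sequentially. cmod (p 0 (\<phi> (t (r j)) (x (r j))) b) < 1"
    using tendstoD[where e = 1] by (force simp: dist_norm)
  then have "\<forall>\<^sub>F j in sequentially. \<forall>b\<in>A 0. cmod (p 0 (\<phi> (t (r j)) (x (r j))) b) < 1"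
    by (rule eventually_ball_finite[OF finite_A])
  then obtain j where "\<forall>b\<in>A 0. cmod (p 0 (\<phi> (t (r j)) (x (r j))) b) < 1"
    using eventually_happens[of _ sequentially] by auto
  then have "cmod (emb (a (r j)) (-1) (a (r j))) < 1"
    using ta(3)[of "r j"] unfolding ta(4) by blast
  then show False by simp
qed

section \<open>From minimality and aperiodicity to primitivity\<close>

text \<open>Ever longer time windows avoiding circle \<open>a\<close>, recentred at their midpoints,
  yield a limit point whose whole orbit avoids it. Such an orbit cannot come near a point over
  \<open>emb a (-1)\<close>, so it is not dense.\<close>

lemma minimal_visits_uniformly:
  assumes min: "minimal_flow X \<phi>" and a: "a \<in> A n"
  obtains T where "\<And>x. x \<in> X \<Longrightarrow> \<exists>t\<in>{0..T}. p n (\<phi> t x) a \<noteq> 0"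
proof (rule ccontr)
  assume "\<not> thesis"
  then have "\<exists>x\<in>X. \<forall>t\<in>{0..T}. p n (\<phi> t x) a = 0" for T
    using that by metis
  \<comment> \<open>The length \<open>2 * real j\<close> leaves \<open>j\<close> units of time on
    either side of the midpoint.\<close>
  then have "\<forall>j::nat. \<exists>x\<in>X. \<forall>t\<in>{0..2 * real j}. p n (\<phi> t x) a = 0" by blast
  then obtain x where x: "\<And>j. x j \<in> X"
      "\<And>j t. t \<in> {0..2 * real j} \<Longrightarrow> p n (\<phi> t (x j)) a = 0"
    by metis
  obtain y r where y: "y \<in> X" "strict_mono r" "(\<lambda>j. \<phi> (real (r j)) (x (r j))) \<longlonglongrightarrow> y"
    using compact_X[unfolded compact_def, rule_format, of "\<lambda>j. \<phi> (real j) (x j)"] x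
    by (auto simp: o_def)
  have zero: "p n (\<phi> t y) a = 0" for t
  proof -
    have "(\<lambda>j. p n (\<phi> t (\<phi> (real (r j)) (x (r j)))) a) \<longlonglongrightarrow> p n (\<phi> t y) a"
      using x y by (intro p_tendsto flow_tendsto) auto
    moreover have "\<forall>\<^sub>F j in sequentially. p n (\<phi> t (\<phi> (real (r j)) (x (r j)))) a = 0"
      using eventually_ge_at_top[of "nat \<lceil>\<bar>t\<bar>\<rceil>"]
    proof eventually_elim
      case (elim j)
      then have "\<bar>t\<bar> \<le> real (r j)" using seq_suble[OF y(2), of j] by linarith
      then have "t + real (r j) \<in> {0..2 * real (r j)}" by auto
      then show ?case using x(1) x(2)[of "t + real (r j)" "r j"] by (simp add: flow_add)
    qed
    ultimately show ?thesis
      by (rule LIMSEQ_unique[OF _ tendsto_eventually])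
  qed
  have "emb a (-1) \<in> wedge (A n)" using a emb_in_circ[of "-1" a] by (auto simp: wedge_eq)
  then obtain w where w: "w \<in> X" "p n w = emb a (-1)" using surj_p by (metis imageE)
  then have "w \<in> closure (orbit \<phi> y)" using min y by (auto simp: minimal_flow_def)
  then obtain q where q: "\<And>k. q k \<in> orbit \<phi> y" "q \<longlonglongrightarrow> w" by (auto simp: closure_sequential)
  have "(\<lambda>k. p n (q k) a) \<longlonglongrightarrow> p n w a"
  proof (rule p_tendsto[OF q(2) _ w(1)])
    show "q k \<in> X" for k using q(1)[of k] y by (auto simp: orbit_def)
  qed
  moreover have "p n (q k) a = 0" for k using q(1)[of k] zero by (auto simp: orbit_def)
  ultimately have "p n w a = 0" by (simp add: LIMSEQ_const_iff)
  then show False using w by simp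
qed

lemma minimal_imp_primitive:
  assumes min: "minimal_flow X \<phi>" and ap: "aperiodic_flow X \<phi>"
  shows "primitive_seq A s"
  unfolding primitive_seq_def
proof
  fix n
  have "\<exists>T. \<forall>x\<in>X. \<exists>t\<in>{0..T}. p n (\<phi> t x) a \<noteq> 0" if "a \<in> A n" for a
    using minimal_visits_uniformly[OF min that] by metis
  then obtain T' where T': "\<And>a x. a \<in> A n \<Longrightarrow> x \<in> X \<Longrightarrow> \<exists>t\<in>{0..T' a}. p n (\<phi> t x) a \<noteq> 0"
    by metis
  obtain T where T: "\<And>a. a \<in> A n \<Longrightarrow> T' a \<le> T"
    using bdd_above_finite[OF finite_imageI[OF finite_A], of T' n] by (auto simp: bdd_above_def)
  \<comment> \<open>Passages more than \<open>2 * T\<close> apart leave, on at least one side of any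
    time off the wedge point, a window of length \<open>T\<close> without a passage.\<close>
  obtain N where N: "\<And>m x \<tau>. \<lbrakk>m \<ge> N; x \<in> X; p m x = wpt; 0 < \<tau>; \<tau> \<le> 2 * T\<rbrakk>
      \<Longrightarrow> p m (\<phi> \<tau> x) \<noteq> wpt"
    using return_times_unbounded[OF ap] by metis
  define m where "m = max N (Suc n)"
  have m: "m > n" "m \<ge> N" by (auto simp: m_def)
  have "a \<in> set (symcomp s n (m - n) b)" if b: "b \<in> A m" and a: "a \<in> A n" for a b
  proof -
    have "emb b (-1) \<in> wedge (A m)" using b emb_in_circ[of "-1" b] by (auto simp: wedge_eq)
    then obtain x where x: "x \<in> X" "p m x = emb b (-1)" using surj_p by (metis imageE)
    have inb: "p m (\<phi> 0 x) \<in> circ b" using x by (simp add: circ_def)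
    have single: "p m (\<phi> t x) \<in> circ b"
      if "connected I" "0 \<in> I" "t \<in> I" "\<And>v. v \<in> I \<Longrightarrow> p m (\<phi> v x) \<noteq> wpt" for I t
      using wedge_path_single_circ[OF that(1) cont_orbit_p[OF x(1), of _ m], of "A m" 0 b t] inb that x
      by auto
    obtain y where y: "y \<in> X" "\<And>t. t \<in> {0..T} \<Longrightarrow> p m (\<phi> t y) \<in> circ b"
    proof (cases "\<exists>t1\<in>{0..T}. p m (\<phi> t1 x) = wpt")
      case False
      then show ?thesis using that[OF x(1)] single[of "{0..T}"] by auto
    next
      case True
      then obtain t1 where t1: "t1 \<in> {0..T}" "p m (\<phi> t1 x) = wpt" by blast
      \<comment> \<open>A passage at \<open>t1\<close> within time \<open>T\<close> after
        \<open>x\<close> excludes one within time \<open>T\<close> before it: the two would be at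
        most \<open>2 * T\<close> apart.\<close>
      have free: "p m (\<phi> v x) \<noteq> wpt" if v: "v \<in> {-T..0}" for v
      proof
        assume z: "p m (\<phi> v x) = wpt"
        have "t1 \<noteq> 0" using t1 x by auto
        then have "p m (\<phi> (t1 - v) (\<phi> v x)) \<noteq> wpt"
          using N[of m "\<phi> v x" "t1 - v"] m x z v t1 by auto
        then show False using t1 x by (simp add: flow_add)
      qed
      \<comment> \<open>Moving the start back by \<open>T\<close> turns the backward window into
        \<open>{0..T}\<close>.\<close>
      have "p m (\<phi> t (\<phi> (-T) x)) \<in> circ b" if "t \<in> {0..T}" for t
        using single[of "{-T..0}" "t - T"] free that x by (simp add: flow_add)
      then show ?thesis using that[of "\<phi> (-T) x"] x by auto
    qed
    obtain t where t: "t \<in> {0..T}" "p n (\<phi> t y) a \<noteq> 0"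
      using T'[OF a y(1)] T[OF a] by force
    have "p n (\<phi> t y) = bonding f n (m - n) (p m (\<phi> t y))"
      using p_eq_bonding[of "\<phi> t y" n "m - n"] y m by simp
    also have "\<dots> \<in> (\<Union>a\<in>set (symcomp s n (m - n) b). circ a)"
      using bonding_circ_image[of b n "m - n"] b m y(2)[OF t(1)] by (simp flip: bonding_circ_image)
    finally obtain a' where a': "a' \<in> set (symcomp s n (m - n) b)" "p n (\<phi> t y) \<in> circ a'"
      by blast
    \<comment> \<open>Points of circle \<open>a'\<close> have no nonzero coordinate other than
      \<open>a'\<close>.\<close>
    then have "a' = a" using t(2) by (auto simp: circ_def emb_def split: if_splits)
    then show ?thesis using a' by simp
  qed
  then show "\<exists>m>n. primitive_map (A m) (A n) (symcomp s n (m - n))"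
    using m by (auto simp: primitive_map_def)
qed

end

theorem theorem3p9:
  fixes X :: "'a::metric_space set" and \<phi> :: "real \<Rightarrow> 'a \<Rightarrow> 'a"
    and A :: "nat \<Rightarrow> 'b set" and s :: "nat \<Rightarrow> 'b \<Rightarrow> 'b list"
  assumes "flow_space X \<phi>"
    and "aperiodic_flow X \<phi>"
    and "symbolic_seq A s"
    and "represents X \<phi> A s"
    and "proper_seq A s"
  shows "minimal_flow X \<phi> \<longleftrightarrow> primitive_seq A s"
proof -
  from assms(4) obtain f p x0 g where rep: "x0 \<in> X"
      "\<forall>i. pos_map (A (Suc i)) (A i) (f i)"
      "\<forall>i. continuous_on X (p i) \<and> p i ` X = wedge (A i) \<and> p i x0 = wpt \<and>
         (\<forall>x\<in>X. pos_path (\<lambda>t. p i (\<phi> t x)) UNIV)"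
      "\<forall>i. \<forall>x\<in>X. p i x = f i (p (Suc i) x)"
      "homeomorphism X (invlim A f) (\<lambda>x i. p i x) g"
      "\<forall>i. \<forall>b\<in>A (Suc i). traverses (\<lambda>t. f i (emb b (cis t))) (s i b)"
    unfolding represents_def by (elim exE conjE) (rule that)
  \<comment> \<open>The inverse \<open>g\<close> of the homeomorphism shows that the projections
    separate points.\<close>
  have inj: "inj_on (\<lambda>x i. p i x) X"
    by (rule inj_on_inverseI[of _ g]) (use rep(5) in \<open>simp add: homeomorphism_def\<close>)
  interpret flow_expansion X \<phi> A s f p x0
    by unfold_locales (use assms(1,3) rep inj in blast)+
  show ?thesis using primitive_imp_minimal minimal_imp_primitive assms(2) by blast
qed

end
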